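(* Let $\Gamma$ be a connected, locally finite, accessible graph. Then the graph $T(\mathcal{C}_{\mathrm{opt}})$ associated with the set $\mathcal{C}_{\mathrm{opt}}$ of optimal cuts of $\Gamma$ is a tree.
   Context: Graphs are undirected; $\Gamma$ is without loops and multiple edges. A graph is connected if any two of its vertices have finite distance, and a tree is a connected graph without cycles (so the empty graph, which arises as $T(\mathcal{C}_{\mathrm{opt}})$ when $\mathcal{C}_{\mathrm{opt}}=\emptyset$, counts as a tree). Cuts. For $C\subseteq V(\Gamma)$ write $\overline{C}=V(\Gamma)\setminus C$ and $\delta C=\{uv\in E(\Gamma): u\in C, v\in\overline{C}\}$. A cut is a subset $C\subseteq V(\Gamma)$ such that $C$ and $\overline{C}$ are non-empty and induce connected subgraphs, and $\delta C$ is finite. A $k$-cut is a cut with $|\delta C|\le k$. Cuts $C,D$ are nested if one of $C\subseteq D$, $C\subseteq\overline{D}$, $\overline{C}\subseteq D$, $\overline{C}\subseteq\overline{D}$ holds. A bi-infinite simple path $\alpha$ is a sequence $(v_i)_{i\in\mathbb{Z}}$ of pairwise distinct vertices with $v_iv_{i+1}\in E(\Gamma)$; $\alpha\cap C$ denotes the set of its vertices in $C$. Put $\mathcal{C}(\alpha)=\{C : C \text{ is a cut and } |\alpha\cap C|=\infty=|\alpha\cap\overline{C}|\}$ and $\mathcal{C}_{\min}(\alpha)=\{C\in\mathcal{C}(\alpha): |\delta C| \text{ is minimal in } \mathcal{C}(\alpha)\}$. $\Gamma$ is accessible if there is $k\in\mathbb{N}$ such that for every bi-infinite simple path $\alpha$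 either $\mathcal{C}(\alpha)=\emptyset$ or $\mathcal{C}(\alpha)$ contains a $k$-cut. Optimal cuts. Fix such a $k$. For a cut $C$ let $m(C)$ be the (finite) number of $k$-cuts $D$ that are not nested with $C$. For a bi-infinite simple path $\alpha$ with $\mathcal{C}(\alpha)\neq\emptyset$ let $m_\alpha=\min\{m(C): C\in\mathcal{C}_{\min}(\alpha)\}$ and $\mathcal{C}_{\mathrm{opt}}(\alpha)=\{C\in\mathcal{C}_{\min}(\alpha): m(C)=m_\alpha\}$ (and $\mathcal{C}_{\mathrm{opt}}(\alpha)=\emptyset$ if $\mathcal{C}(\alpha)=\emptyset$). Then $\mathcal{C}_{\mathrm{opt}}=\bigcup_\alpha \mathcal{C}_{\mathrm{opt}}(\alpha)$ over all bi-infinite simple paths $\alpha$; its elements are called optimal cuts. The graph $T(\mathcal{C}_{\mathrm{opt}})$. For $C,D\in\mathcal{C}_{\mathrm{opt}}$ let $C\sim D$ if either $C=D$, or both $\overline{C}\subsetneq D$ and for all $E\in\mathcal{C}_{\mathrm{opt}}$: $\overline{C}\subsetneq E\subseteq D$ implies $D=E$. This is an equivalence relation with classes $[C]$. $T(\mathcal{C}_{\mathrm{opt}})$ is the undirected graph with vertex set $\{[C]: C\in\mathcal{C}_{\mathrm{opt}}\}$ and edges $(C,\overline{C})$, $C\in\mathcal{C}_{\mathrm{opt}}$, where $(C,\overline{C})$ goes from $[C]$ to $[\overline{C}]$ and its inverse edge is $(\overline{C},C)$; it has no loops and no multiple edges. *)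

theory Defs
  imports "Graph_Theory.Graph_Theory"
begin

text \<open>
  Undirected graphs are symmetric digraphs, each undirected edge being a pair of mutually inverse
  arcs. A simple, possibly infinite undirected graph is a \<open>pair_bidirected_digraph\<close>; a graph with a
  fixed-point-free inversion of its edges (possibly with loops and multiple edges) is a
  \<open>bidirected_digraph\<close>.
\<close>

section \<open>Connected graphs and trees\<close>

text \<open>
  Unlike the library's \<open>connected\<close>, this admits the empty graph. It is meant for symmetric digraphs,
  where reachability says that the distance is finite.
\<close>

definition conn :: "('a, 'b) pre_digraph \<Rightarrow> bool" where
  "conn G \<longleftrightarrow> (\<forall>u\<in>verts G. \<forall>v\<in>verts G. u \<rightarrow>\<^sup>*\<^bsub>G\<^esub> v)"

text \<open>
  A directed cycle of the symmetric digraph is a cycle of the undirected graph unless it runs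
  through one edge back and forth. Loops and pairs of parallel edges are cycles. (The library's
  \<open>tree\<close> counts back-and-forth walks as cycles, so it does not apply to symmetric digraphs.)
\<close>

definition ucycle :: "('a, 'b) pre_digraph \<Rightarrow> ('b \<Rightarrow> 'b) \<Rightarrow> 'b awalk \<Rightarrow> bool" where
  "ucycle G arev p \<longleftrightarrow> pre_digraph.cycle G p \<and> (\<nexists>e. p = [e, arev e])"

definition utree :: "('a, 'b) pre_digraph \<Rightarrow> ('b \<Rightarrow> 'b) \<Rightarrow> bool" where
  "utree G arev \<longleftrightarrow> bidirected_digraph G arev \<and> conn G \<and> (\<nexists>p. ucycle G arev p)"

definition locally_finite :: "('a, 'b) pre_digraph \<Rightarrow> bool" where
  "locally_finite G \<longleftrightarrow> (\<forall>v\<in>verts G. finite (out_arcs G v))"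

section \<open>Cuts\<close>

abbreviation compl_in :: "'a pair_pre_digraph \<Rightarrow> 'a set \<Rightarrow> 'a set" where
  "compl_in G C \<equiv> pverts G - C"

text \<open>
  Of the two arcs of an undirected edge between \<open>C\<close> and its complement, exactly the one leaving \<open>C\<close>
  is taken, so cardinalities agree with those of sets of undirected edges.
\<close>

definition boundary :: "'a pair_pre_digraph \<Rightarrow> 'a set \<Rightarrow> ('a \<times> 'a) set" where
  "boundary G C = {(u, v) \<in> parcs G. u \<in> C \<and> v \<in> compl_in G C}"

definition is_cut :: "'a pair_pre_digraph \<Rightarrow> 'a set \<Rightarrow> bool" where
  "is_cut G C \<longleftrightarrow> C \<subseteq> pverts G \<and> C \<noteq> {} \<and> compl_in G C \<noteq> {} \<and>
     conn (with_proj G \<restriction> C) \<and> conn (with_proj G \<restriction> compl_in G C) \<and> finite (boundary G C)"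

definition is_kcut :: "'a pair_pre_digraph \<Rightarrow> nat \<Rightarrow> 'a set \<Rightarrow> bool" where
  "is_kcut G k C \<longleftrightarrow> is_cut G C \<and> card (boundary G C) \<le> k"

definition nested :: "'a pair_pre_digraph \<Rightarrow> 'a set \<Rightarrow> 'a set \<Rightarrow> bool" where
  "nested G C D \<longleftrightarrow> C \<subseteq> D \<or> C \<subseteq> compl_in G D \<or> compl_in G C \<subseteq> D \<or> compl_in G C \<subseteq> compl_in G D"

definition bi_inf_path :: "'a pair_pre_digraph \<Rightarrow> (int \<Rightarrow> 'a) \<Rightarrow> bool" where
  "bi_inf_path G \<alpha> \<longleftrightarrow> inj \<alpha> \<and> range \<alpha> \<subseteq> pverts G \<and> (\<forall>i. (\<alpha> i, \<alpha> (i + 1)) \<in> parcs G)"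

definition cuts :: "'a pair_pre_digraph \<Rightarrow> (int \<Rightarrow> 'a) \<Rightarrow> 'a set set" where
  "cuts G \<alpha> = {C. is_cut G C \<and> infinite (range \<alpha> \<inter> C) \<and> infinite (range \<alpha> \<inter> compl_in G C)}"

definition cuts_min :: "'a pair_pre_digraph \<Rightarrow> (int \<Rightarrow> 'a) \<Rightarrow> 'a set set" where
  "cuts_min G \<alpha> = {C. is_arg_min (\<lambda>C. card (boundary G C)) (\<lambda>C. C \<in> cuts G \<alpha>) C}"

definition accessible_with :: "'a pair_pre_digraph \<Rightarrow> nat \<Rightarrow> bool" where
  "accessible_with G k \<longleftrightarrow>
     (\<forall>\<alpha>. bi_inf_path G \<alpha> \<longrightarrow> cuts G \<alpha> = {} \<or> (\<exists>C\<in>cuts G \<alpha>. is_kcut G k C))"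

definition accessible :: "'a pair_pre_digraph \<Rightarrow> bool" where
  "accessible G \<longleftrightarrow> (\<exists>k. accessible_with G k)"

section \<open>Optimal cuts\<close>

text \<open>
  For a cut \<open>C\<close> of a connected, locally finite graph the set counted here is finite.
\<close>

definition crossing_number :: "'a pair_pre_digraph \<Rightarrow> nat \<Rightarrow> 'a set \<Rightarrow> nat" where
  "crossing_number G k C = card {D. is_kcut G k D \<and> \<not> nested G C D}"

definition cuts_opt_path :: "'a pair_pre_digraph \<Rightarrow> nat \<Rightarrow> (int \<Rightarrow> 'a) \<Rightarrow> 'a set set" where
  "cuts_opt_path G k \<alpha> = {C. is_arg_min (crossing_number G k) (\<lambda>C. C \<in> cuts_min G \<alpha>) C}"

definition cuts_opt :: "'a pair_pre_digraph \<Rightarrow> nat \<Rightarrow> 'a set set" where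
  "cuts_opt G k = (\<Union>\<alpha>\<in>{\<alpha>. bi_inf_path G \<alpha>}. cuts_opt_path G k \<alpha>)"

section \<open>The graph associated with a set of cuts\<close>

definition cut_rel :: "'a pair_pre_digraph \<Rightarrow> 'a set set \<Rightarrow> 'a set rel" where
  "cut_rel G \<C> = {(C, D). C \<in> \<C> \<and> D \<in> \<C> \<and>
     (C = D \<or>
      compl_in G C \<subset> D \<and> (\<forall>E\<in>\<C>. compl_in G C \<subset> E \<and> E \<subseteq> D \<longrightarrow> D = E))}"

definition cut_graph ::
    "'a pair_pre_digraph \<Rightarrow> 'a set set \<Rightarrow> ('a set set, 'a set \<times> 'a set) pre_digraph" where
  "cut_graph G \<C> =
    \<lparr> verts = \<C> // cut_rel G \<C>,
      arcs = {(C, compl_in G C) | C. C \<in> \<C>},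
      tail = (\<lambda>(C, D). cut_rel G \<C> `` {C}),
      head = (\<lambda>(C, D). cut_rel G \<C> `` {D}) \<rparr>"

text \<open>
  The inverse of the edge \<open>(C, D)\<close> is \<open>(D, C)\<close>; \<open>bidirected_digraph\<close> asks for the identity off the
  edge set.
\<close>

definition cut_graph_rev ::
    "'a pair_pre_digraph \<Rightarrow> 'a set set \<Rightarrow> 'a set \<times> 'a set \<Rightarrow> 'a set \<times> 'a set" where
  "cut_graph_rev G \<C> e = (if e \<in> arcs (cut_graph G \<C>) then prod.swap e else e)"

end

theory Submission
  imports Defs
begin

text \<open>
  A set with finite boundary that separates the two ends of a path and has minimal boundary among all
  such sets is automatically a cut, so minimal cuts can be uncrossed without caring about
  connectedness. If optimal cuts \<open>C\<close> and \<open>D\<close> for paths \<open>\<alpha>\<close> and \<open>\<beta>\<close> cross, then, up to complements,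
  \<open>C \<inter> D\<close> separates \<open>\<alpha>\<close> and \<open>C \<union> D\<close> separates \<open>\<beta>\<close>. By submodularity both corners are again
  minimal, but their crossing numbers add up to less than those of \<open>C\<close> and \<open>D\<close>, which contradicts
  optimality. (If each cut separates both paths, then both are optimal for \<open>\<alpha>\<close>, and \<open>\<beta>\<close> is replaced
  by \<open>\<alpha>\<close> first.) So optimal cuts are nested. Only finitely many small cuts separate two given vertices;
  hence between two nested optimal cuts there are only finitely many others, which makes the graph
  connected. A walk without backtracking runs through a strictly increasing chain of cuts and cannot
  close up to a cycle.
\<close>

section \<open>Nested sets and corners\<close>

lemma nested_commute:
  assumes "C \<subseteq> pverts G" "D \<subseteq> pverts G"
  shows "nested G C D \<longleftrightarrow> nested G D C"
  using assms unfolding nested_def by blast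

lemma nested_compl_left:
  assumes "C \<subseteq> pverts G"
  shows "nested G (compl_in G C) D \<longleftrightarrow> nested G C D"
  using assms unfolding nested_def by (auto simp: double_diff)

lemma nested_compl_right:
  assumes "D \<subseteq> pverts G"
  shows "nested G C (compl_in G D) \<longleftrightarrow> nested G C D"
  using assms unfolding nested_def by (auto simp: double_diff)

text \<open>Some side of \<open>E\<close> lies in a side of \<open>C\<close>, and some side of
  \<open>E\<close> in a side of \<open>D\<close>. Were these different sides of \<open>E\<close>,
  two sides of \<open>C\<close> and \<open>D\<close> would cover everything, against crossing. So
  one side of \<open>E\<close> lies in a single corner, and every corner contains it or misses
  it.\<close>

lemma nested_corners:
  assumes "C \<subseteq> pverts G" "D \<subseteq> pverts G" "E \<subseteq> pverts G" "\<not> nested G C D"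
    and "nested G C E" "nested G D E"
  shows "nested G (C \<inter> D) E" "nested G (C \<union> D) E"
proof -
  have "\<exists>x. x \<in> C \<and> x \<in> D" "\<exists>x. x \<in> C \<and> x \<notin> D" "\<exists>x. x \<notin> C \<and> x \<in> D"
    "\<exists>x. x \<in> pverts G \<and> x \<notin> C \<and> x \<notin> D"
    using assms(1-4) unfolding nested_def by blast+
  then show "nested G (C \<inter> D) E" "nested G (C \<union> D) E"
    using assms(1-3,5,6) unfolding nested_def by blast+
qed

text \<open>A side of \<open>E\<close> inside \<open>C\<close> lies in \<open>C \<union> D\<close>,
  and one outside \<open>C\<close> misses \<open>C \<inter> D\<close>. Hence whatever crosses both
  corners crosses \<open>C\<close>, and by symmetry \<open>D\<close>.\<close>

lemma nested_some_corner:
  assumes "C \<subseteq> pverts G" "D \<subseteq> pverts G" "E \<subseteq> pverts G" and "nested G C E"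
  shows "nested G (C \<inter> D) E \<or> nested G (C \<union> D) E"
  using assms unfolding nested_def by blast

text \<open>Both sums equal union plus intersection. Serves for boundaries and for sets of crossing
  cuts alike.\<close>

lemma card_add_le_card_add:
  assumes "finite P" "finite Q" "X \<union> Y \<subseteq> P \<union> Q" "X \<inter> Y \<subseteq> P \<inter> Q"
  shows "card X + card Y \<le> card P + card Q"
proof -
  have "finite X" "finite Y" using assms(1-3) by (meson finite_Un finite_subset)+
  then have "card X + card Y = card (X \<union> Y) + card (X \<inter> Y)" by (rule card_Un_Int)
  also have "\<dots> \<le> card (P \<union> Q) + card (P \<inter> Q)"
    using assms by (intro add_mono card_mono) auto
  also have "\<dots> = card P + card Q" using card_Un_Int[OF assms(1,2)] by simp
  finally show ?thesis .
qed

text \<open>An arc leaving \<open>C \<inter> D\<close> or \<open>C \<union> D\<close> leaves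
  \<open>C\<close> or \<open>D\<close>, and an arc leaving both of the former leaves both of the
  latter.\<close>

lemma card_boundary_submodular:
  assumes "finite (boundary G C)" "finite (boundary G D)"
  shows "card (boundary G (C \<inter> D)) + card (boundary G (C \<union> D))
    \<le> card (boundary G C) + card (boundary G D)"
  by (rule card_add_le_card_add) (use assms in \<open>auto simp: boundary_def\<close>)

section \<open>Finitely many small cuts separate two vertices\<close>

lemma rtrancl_on_in_subset:
  assumes "(x, y) \<in> rtrancl_on C r" and "C \<subseteq> F" and "r \<inter> C \<times> C \<subseteq> s"
  shows "(x, y) \<in> rtrancl_on F s"
  using assms(1)
proof (induction rule: rtrancl_on_induct)
  case base
  then show ?case using assms(2) by auto
next
  case (step y z)
  then have "(y, z) \<in> s" "z \<in> F" using assms(2,3) by auto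
  then show ?case using step.IH by (meson rtrancl_on_into_rtrancl_on)
qed

lemma rtrancl_on_leaves:
  assumes "(x, y) \<in> rtrancl_on F r" and "x \<in> A" and "y \<notin> A"
  obtains a b where "(a, b) \<in> r" "a \<in> A" "b \<notin> A" "a \<in> F" "b \<in> F"
  using assms
proof (induction arbitrary: thesis rule: rtrancl_on_induct)
  case base
  then show ?case by simp
next
  case (step y z)
  then show ?case by blast
qed

text \<open>\<open>P\<close> consists of the arcs of one walk from \<open>x\<close> to
  \<open>y\<close>. It does not depend on \<open>A\<close>, so it splits the sets separating
  \<open>x\<close> from \<open>y\<close> into finitely many families, each with a prescribed leaving
  arc.\<close>

lemma rtrancl_on_finite_transversal:
  assumes "(x, y) \<in> rtrancl_on F r"
  obtains P where "finite P" "P \<subseteq> r \<inter> F \<times> F"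
    "\<And>A. x \<in> A \<Longrightarrow> y \<notin> A \<Longrightarrow> \<exists>(a, b)\<in>P. a \<in> A \<and> b \<notin> A"
  using assms
proof (induction arbitrary: thesis rule: rtrancl_on_induct)
  case base
  from base(2)[of "{}"] show ?case by simp
next
  case (step y z)
  obtain P where P: "finite P" "P \<subseteq> r \<inter> F \<times> F"
    "\<And>A. x \<in> A \<Longrightarrow> y \<notin> A \<Longrightarrow> \<exists>(a, b)\<in>P. a \<in> A \<and> b \<notin> A"
    using step.IH by blast
  show ?case
  proof (rule step.prems)
    show "finite (insert (y, z) P)" "insert (y, z) P \<subseteq> r \<inter> F \<times> F" using P step.hyps by auto
    show "\<exists>(a, b)\<in>insert (y, z) P. a \<in> A \<and> b \<notin> A" if "x \<in> A" "z \<notin> A" for A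
      using P(3)[of A] that by (cases "y \<in> A") auto
  qed
qed

text \<open>A bare arc relation, not necessarily symmetric, is used here because the induction below
  deletes single arcs in one direction only.\<close>

definition conn_set :: "'a rel \<Rightarrow> 'a set \<Rightarrow> bool" where
  "conn_set r C \<longleftrightarrow> (\<forall>u\<in>C. \<forall>v\<in>C. (u, v) \<in> rtrancl_on C r)"

text \<open>
  Deleting the arc \<open>(u, v)\<close> keeps both sides of \<open>C\<close> connected and lowers the number of leaving arcs.
  If \<open>v\<close> stays reachable, every such \<open>C\<close> is also left by an arc of a fixed path; otherwise \<open>C\<close> must
  be the set of vertices reachable from \<open>u\<close>.
\<close>

lemma finite_cuts_through_arc:
  assumes "(u, v) \<in> r"
  shows "finite {C. C \<subseteq> V \<and> u \<in> C \<and> v \<in> V - C \<and> conn_set r C \<and> conn_set r (V - C) \<and>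
    finite (boundary \<lparr>pverts = V, parcs = r\<rparr> C) \<and> card (boundary \<lparr>pverts = V, parcs = r\<rparr> C) \<le> k}"
    (is "finite (?K r u v k)")
  using assms
proof (induction k arbitrary: r u v)
  case 0
  have "(u, v) \<in> boundary \<lparr>pverts = V, parcs = r\<rparr> C" if "u \<in> C" "v \<in> V - C" for C
    using that 0 by (simp add: boundary_def)
  then have "?K r u v 0 = {}"
    by (fastforce simp: card_eq_0_iff)
  then show ?case by (metis finite.emptyI)
next
  case (Suc k)
  let ?s = "r - {(u, v)}"
  \<comment> \<open>Walks inside \<open>C\<close> never use an arc with an end outside
    \<open>C\<close>; for a cut left by \<open>(u, v)\<close> this applies to both sides.\<close>
  have conn_s: "conn_set ?s C" if "conn_set r C" "u \<notin> C \<or> v \<notin> C" for C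
    using that unfolding conn_set_def
    by (auto intro!: rtrancl_on_in_subset[where C = C and r = r and F = C and s = ?s])
  show ?case
  proof (cases "(u, v) \<in> rtrancl_on V ?s")
    case True
    then obtain P where P: "finite P" "P \<subseteq> ?s \<inter> V \<times> V"
      "\<And>A. u \<in> A \<Longrightarrow> v \<notin> A \<Longrightarrow> \<exists>(a, b)\<in>P. a \<in> A \<and> b \<notin> A"
      by (rule rtrancl_on_finite_transversal) blast
    have "?K r u v (Suc k) \<subseteq> (\<Union>(a, b)\<in>P. ?K ?s a b k)"
    proof
      fix C assume C: "C \<in> ?K r u v (Suc k)"
      then obtain a b where ab: "(a, b) \<in> P" "a \<in> C" "b \<in> V - C"
        using P(2) P(3)[of C] by blast
      let ?B = "boundary \<lparr>pverts = V, parcs = r\<rparr> C"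
      have "boundary \<lparr>pverts = V, parcs = ?s\<rparr> C = ?B - {(u, v)}"
        by (auto simp: boundary_def)
      moreover have "(u, v) \<in> ?B" using C Suc.prems by (auto simp: boundary_def)
      ultimately have "finite (boundary \<lparr>pverts = V, parcs = ?s\<rparr> C) \<and>
          card (boundary \<lparr>pverts = V, parcs = ?s\<rparr> C) \<le> k"
        using C by auto
      then have "C \<in> ?K ?s a b k" using C ab conn_s by auto
      then show "C \<in> (\<Union>(a, b)\<in>P. ?K ?s a b k)" using ab by blast
    qed
    moreover have "finite (?K ?s a b k)" if "(a, b) \<in> P" for a b
      using Suc.IH that P(2) by blast
    then have "finite (\<Union>(a, b)\<in>P. ?K ?s a b k)" using P(1) by auto
    ultimately show ?thesis by (rule finite_subset)
  next
    case False
    have "C = {x. (u, x) \<in> rtrancl_on V ?s}" if C: "C \<in> ?K r u v (Suc k)" for C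
    proof (rule set_eqI)
      fix x
      have uC: "u \<in> C" "v \<in> V - C" "C \<subseteq> V" using C by auto
      have conn: "conn_set ?s C" "conn_set ?s (V - C)" using C conn_s by auto
      have "(u, x) \<in> rtrancl_on V ?s" if "x \<in> C"
        using conn(1) that uC unfolding conn_set_def
        by (blast intro: rtrancl_on_in_subset[where C = C])
      moreover have False if "(u, x) \<in> rtrancl_on V ?s" "x \<notin> C"
      proof -
        have "x \<in> V" using that(1) by (rule in_rtrancl_on_in_F)
        then have "(x, v) \<in> rtrancl_on (V - C) ?s"
          using conn(2) that uC unfolding conn_set_def by blast
        then have "(x, v) \<in> rtrancl_on V ?s"
          by (rule rtrancl_on_in_subset) auto
        then show False using that False by (meson rtrancl_on_trans)
      qed
      ultimately show "x \<in> C \<longleftrightarrow> x \<in> {x. (u, x) \<in> rtrancl_on V ?s}" by blast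
    qed
    then have "?K r u v (Suc k) \<subseteq> {{x. (u, x) \<in> rtrancl_on V ?s}}" by blast
    then show ?thesis by (rule finite_subset) simp
  qed
qed

lemma boundary_eta: "boundary \<lparr>pverts = pverts G, parcs = parcs G\<rparr> C = boundary G C"
  by (simp add: boundary_def)

lemma conn_induce_iff:
  assumes "C \<subseteq> pverts G"
  shows "conn (with_proj G \<restriction> C) \<longleftrightarrow> conn_set (parcs G) C"
proof -
  have "arcs_ends (with_proj G \<restriction> C) = parcs G \<inter> C \<times> C"
    by (auto simp: arcs_ends_conv arc_to_ends_def induce_subgraph_def)
  then have "rtrancl_on C (arcs_ends (with_proj G \<restriction> C)) = rtrancl_on C (parcs G)"
    by (auto elim!: rtrancl_on_in_subset)
  then show ?thesis by (simp add: conn_def conn_set_def reachable_def)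
qed

lemma is_cut_iff:
  "is_cut G C \<longleftrightarrow> C \<subseteq> pverts G \<and> C \<noteq> {} \<and> compl_in G C \<noteq> {} \<and>
     conn_set (parcs G) C \<and> conn_set (parcs G) (compl_in G C) \<and> finite (boundary G C)"
  unfolding is_cut_def using conn_induce_iff[of C G] conn_induce_iff[of "compl_in G C" G] by auto

text \<open>Only the forward direction is treated; the backward ray is reached through
  \<open>\<alpha> \<circ> uminus\<close>, so each fact about rays is proved once.\<close>

definition ends_in :: "(int \<Rightarrow> 'a) \<Rightarrow> 'a set \<Rightarrow> bool" where
  "ends_in \<alpha> A \<longleftrightarrow> (\<exists>N. \<forall>i\<ge>N. \<alpha> i \<in> A)"

lemma ends_in_Int: "ends_in \<alpha> (A \<inter> B) \<longleftrightarrow> ends_in \<alpha> A \<and> ends_in \<alpha> B"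
proof
  assume "ends_in \<alpha> A \<and> ends_in \<alpha> B"
  then obtain M N where "\<forall>i\<ge>M. \<alpha> i \<in> A" "\<forall>i\<ge>N. \<alpha> i \<in> B"
    unfolding ends_in_def by blast
  then have "\<forall>i\<ge>max M N. \<alpha> i \<in> A \<inter> B" by simp
  then show "ends_in \<alpha> (A \<inter> B)" unfolding ends_in_def by blast
qed (unfold ends_in_def, blast)

lemma range_comp_uminus: "range (\<alpha> \<circ> uminus) = range (\<alpha> :: int \<Rightarrow> 'a)"
  by (metis image_comp surj_uminus)

locale connected_pair_graph = pair_bidirected_digraph G for G :: "'a pair_pre_digraph" +
  assumes conn_G: "conn (with_proj G)"
begin

lemma reachable_G: "u \<in> pverts G \<Longrightarrow> v \<in> pverts G \<Longrightarrow> (u, v) \<in> rtrancl_on (pverts G) (parcs G)"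
  using conn_G by (simp add: conn_def reachable_def)

lemma parcs_sym: "(u, v) \<in> parcs G \<Longrightarrow> (v, u) \<in> parcs G"
  using arcs_symmetric by blast

lemma parcs_in_pverts: "(u, v) \<in> parcs G \<Longrightarrow> u \<in> pverts G \<and> v \<in> pverts G"
  using in_arcsD1 in_arcsD2 by blast

lemma finite_kcuts_separating:
  assumes "u \<in> pverts G" "v \<in> pverts G"
  shows "finite {C. is_kcut G k C \<and> u \<in> C \<and> v \<notin> C}"
proof -
  obtain P where P: "finite P" "P \<subseteq> parcs G \<inter> pverts G \<times> pverts G"
      "\<And>A. u \<in> A \<Longrightarrow> v \<notin> A \<Longrightarrow> \<exists>(a, b)\<in>P. a \<in> A \<and> b \<notin> A"
    using reachable_G[OF assms] by (rule rtrancl_on_finite_transversal) blast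
  let ?K = "\<lambda>a b. {C. is_kcut G k C \<and> a \<in> C \<and> b \<in> pverts G - C}"
  have "finite (?K a b)" if "(a, b) \<in> P" for a b
    by (rule finite_subset[OF _ finite_cuts_through_arc[of a b "parcs G" "pverts G" k]])
      (use that P(2) in \<open>auto simp: is_kcut_def is_cut_iff boundary_eta\<close>)
  then have "finite (\<Union>(a, b)\<in>P. ?K a b)" using P(1) by auto
  then show ?thesis
  proof (rule finite_subset[rotated], intro subsetI)
    fix C assume C: "C \<in> {C. is_kcut G k C \<and> u \<in> C \<and> v \<notin> C}"
    then obtain a b where "(a, b) \<in> P" "a \<in> C" "b \<notin> C" using P(3)[of C] by blast
    then show "C \<in> (\<Union>(a, b)\<in>P. ?K a b)" using P(2) C by blast
  qed
qed

text \<open>If \<open>D\<close> crosses \<open>C\<close>, then \<open>D\<close> and its complement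
  each meet both sides of \<open>C\<close>. Being connected, each contains the start of an arc that
  leaves \<open>C\<close>. So \<open>D\<close> separates two of finitely many vertices.\<close>

lemma finite_crossing:
  assumes "is_cut G C"
  shows "finite {D. is_kcut G k D \<and> \<not> nested G C D}"
proof -
  let ?E = "fst ` boundary G C"
  let ?K = "\<lambda>x y. {D. is_kcut G k D \<and> x \<in> D \<and> y \<notin> D}"
  have exit: "\<exists>x\<in>?E. x \<in> D" if D: "conn_set (parcs G) D" "D \<inter> C \<noteq> {}" "D - C \<noteq> {}" "D \<subseteq> pverts G" for D
  proof -
    obtain x y where "x \<in> D \<inter> C" "y \<in> D - C" using D by blast
    then have "(x, y) \<in> rtrancl_on D (parcs G)" "x \<in> C" "y \<notin> C"
      using D(1) by (auto simp: conn_set_def)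
    then obtain a b where "(a, b) \<in> parcs G" "a \<in> C" "b \<notin> C" "a \<in> D" "b \<in> D"
      by (rule rtrancl_on_leaves)
    then have "(a, b) \<in> boundary G C" "a \<in> D" using D(4) by (auto simp: boundary_def)
    then show ?thesis by force
  qed
  have "{D. is_kcut G k D \<and> \<not> nested G C D} \<subseteq> (\<Union>x\<in>?E. \<Union>y\<in>?E. ?K x y)"
  proof
    fix D assume D: "D \<in> {D. is_kcut G k D \<and> \<not> nested G C D}"
    have "\<exists>x\<in>?E. x \<in> D"
      by (rule exit) (use D assms in \<open>auto simp: is_kcut_def is_cut_iff nested_def\<close>)
    moreover have "\<exists>x\<in>?E. x \<in> compl_in G D"
      by (rule exit) (use D assms in \<open>auto simp: is_kcut_def is_cut_iff nested_def\<close>)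
    ultimately show "D \<in> (\<Union>x\<in>?E. \<Union>y\<in>?E. ?K x y)" using D by blast
  qed
  moreover have "finite (\<Union>x\<in>?E. \<Union>y\<in>?E. ?K x y)"
    using assms by (intro finite_UN_I finite_imageI finite_kcuts_separating)
      (auto simp: is_cut_iff boundary_def)
  ultimately show ?thesis by (rule finite_subset)
qed

section \<open>Minimal separators of a bi-infinite path are cuts\<close>

lemma boundary_compl:
  assumes "A \<subseteq> pverts G"
  shows "boundary G (compl_in G A) = (boundary G A)\<inverse>"
  using assms parcs_sym parcs_in_pverts by (auto simp: boundary_def)

lemma finite_boundary_compl [simp]:
  "A \<subseteq> pverts G \<Longrightarrow> finite (boundary G (compl_in G A)) \<longleftrightarrow> finite (boundary G A)"
  by (simp add: boundary_compl)

lemma card_boundary_compl [simp]: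
  "A \<subseteq> pverts G \<Longrightarrow> card (boundary G (compl_in G A)) = card (boundary G A)"
  by (simp add: boundary_compl)

lemma boundary_empty_iff:
  assumes "A \<subseteq> pverts G"
  shows "boundary G A = {} \<longleftrightarrow> A = {} \<or> A = pverts G"
proof
  assume *: "boundary G A = {}"
  show "A = {} \<or> A = pverts G"
  proof (rule ccontr)
    assume "\<not> ?thesis"
    then obtain u v where uv: "u \<in> A" "v \<in> pverts G" "v \<notin> A" using assms by blast
    then have "(u, v) \<in> rtrancl_on (pverts G) (parcs G)" using assms reachable_G by blast
    then obtain a b where "(a, b) \<in> parcs G" "a \<in> A" "b \<notin> A" "b \<in> pverts G"
      using uv(1,3) by (rule rtrancl_on_leaves)
    then show False using * by (auto simp: boundary_def)
  qed
qed (auto simp: boundary_def)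

text \<open>An injective path uses every arc at most once, so it crosses a finite boundary finitely
  often and finally stays on one side.\<close>

lemma ends_in_compl:
  assumes \<alpha>: "bi_inf_path G \<alpha>" and A: "A \<subseteq> pverts G" "finite (boundary G A)"
  shows "ends_in \<alpha> (compl_in G A) \<longleftrightarrow> \<not> ends_in \<alpha> A"
proof
  assume "ends_in \<alpha> (compl_in G A)"
  moreover have "\<not> ends_in \<alpha> (A \<inter> compl_in G A)"
    unfolding ends_in_def by blast
  ultimately show "\<not> ends_in \<alpha> A" by (simp only: ends_in_Int) blast
next
  assume not_A: "\<not> ends_in \<alpha> A"
  \<comment> \<open>\<open>boundary\<close> holds only leaving arcs; the converse adds the steps by
    which \<open>\<alpha>\<close> enters \<open>A\<close>.\<close>
  let ?S = "{i. (\<alpha> i, \<alpha> (i + 1)) \<in> boundary G A \<union> (boundary G A)\<inverse>}"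
  have "inj \<alpha>" using \<alpha> by (simp add: bi_inf_path_def)
  then have "inj (\<lambda>i. (\<alpha> i, \<alpha> (i + 1)))" by (auto simp: inj_def)
  then have "finite ((\<lambda>i. (\<alpha> i, \<alpha> (i + 1))) -` (boundary G A \<union> (boundary G A)\<inverse>))"
    using A(2) by (intro finite_vimageI) auto
  then have "finite ?S" by (simp add: vimage_def)
  then have "bdd_above ?S" by simp
  then obtain N where N: "\<And>i. i \<in> ?S \<Longrightarrow> i \<le> N" by (auto simp: bdd_above_def)
  have same_side: "\<alpha> i \<in> A \<longleftrightarrow> \<alpha> (i + 1) \<in> A" if "i > N" for i
  proof -
    have "(\<alpha> i, \<alpha> (i + 1)) \<in> parcs G" using \<alpha> by (simp add: bi_inf_path_def)
    moreover have "i \<notin> ?S" using N[of i] that by linarith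
    ultimately show ?thesis
      using parcs_sym[of "\<alpha> i" "\<alpha> (i + 1)"] parcs_in_pverts[of "\<alpha> i" "\<alpha> (i + 1)"]
      unfolding boundary_def by blast
  qed
  have const: "\<alpha> i \<in> A \<longleftrightarrow> \<alpha> (N + 1) \<in> A" if "i \<ge> N + 1" for i
    using that
  proof (induction i rule: int_ge_induct)
    case (step i)
    then show ?case using same_side[of i] by simp
  qed simp
  have "\<alpha> (N + 1) \<notin> A" using not_A const unfolding ends_in_def by blast
  then have "\<forall>i\<ge>N + 1. \<alpha> i \<in> compl_in G A"
    using const \<alpha> unfolding bi_inf_path_def by blast
  then show "ends_in \<alpha> (compl_in G A)" unfolding ends_in_def by blast
qed

lemma bi_inf_path_reverse:
  assumes "bi_inf_path G \<alpha>"
  shows "bi_inf_path G (\<alpha> \<circ> uminus)"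
proof -
  have "(\<alpha> (- i), \<alpha> (- (i + 1))) \<in> parcs G" for i
  proof -
    have "(\<alpha> (- (i + 1)), \<alpha> (- (i + 1) + 1)) \<in> parcs G"
      using assms unfolding bi_inf_path_def by blast
    then show ?thesis using parcs_sym by simp
  qed
  then show ?thesis
    using assms range_comp_uminus[of \<alpha>] unfolding bi_inf_path_def
    by (simp add: inj_compose)
qed

text \<open>The members of \<open>cuts G \<alpha>\<close> are those separators whose two sides are
  connected, a condition that corners of cuts may violate.\<close>

definition separators :: "(int \<Rightarrow> 'a) \<Rightarrow> 'a set set" where
  "separators \<alpha> = {A. A \<subseteq> pverts G \<and> finite (boundary G A) \<and>
     infinite (range \<alpha> \<inter> A) \<and> infinite (range \<alpha> \<inter> compl_in G A)}"

lemma separators_compl: "A \<in> separators \<alpha> \<Longrightarrow> compl_in G A \<in> separators \<alpha>"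
  by (auto simp: separators_def double_diff)

lemma cuts_eq: "cuts G \<alpha> = {C \<in> separators \<alpha>. is_cut G C}"
  by (auto simp: cuts_def separators_def is_cut_iff)

text \<open>Injectivity makes every tail infinite. If neither ray stays in \<open>A\<close>, both
  finally stay outside it, and only a finite middle segment can meet \<open>A\<close>.\<close>

lemma infinite_range_Int_iff:
  assumes \<alpha>: "bi_inf_path G \<alpha>" and A: "A \<subseteq> pverts G" "finite (boundary G A)"
  shows "infinite (range \<alpha> \<inter> A) \<longleftrightarrow> ends_in \<alpha> A \<or> ends_in (\<alpha> \<circ> uminus) A"
proof
  have inf: "infinite (range \<beta> \<inter> A)" if "bi_inf_path G \<beta>" "ends_in \<beta> A" for \<beta>
  proof -
    from that(2) obtain N where N: "\<forall>i\<ge>N. \<beta> i \<in> A" by (auto simp: ends_in_def)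
    have "inj_on \<beta> {N..}" using that(1) by (auto simp: bi_inf_path_def inj_on_def)
    then have "infinite (\<beta> ` {N..})" by (simp add: finite_image_iff infinite_Ici)
    then show ?thesis by (rule infinite_super[rotated]) (use N in auto)
  qed
  assume "ends_in \<alpha> A \<or> ends_in (\<alpha> \<circ> uminus) A"
  then show "infinite (range \<alpha> \<inter> A)"
    using inf[OF \<alpha>] inf[OF bi_inf_path_reverse[OF \<alpha>], unfolded range_comp_uminus] by blast
next
  assume inf: "infinite (range \<alpha> \<inter> A)"
  show "ends_in \<alpha> A \<or> ends_in (\<alpha> \<circ> uminus) A"
  proof (rule ccontr)
    assume "\<not> ?thesis"
    then have "ends_in \<alpha> (compl_in G A)" "ends_in (\<alpha> \<circ> uminus) (compl_in G A)"
      using ends_in_compl[OF \<alpha> A] ends_in_compl[OF bi_inf_path_reverse[OF \<alpha>] A] by auto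
    then obtain M N where MN: "\<And>i. i \<ge> M \<Longrightarrow> \<alpha> i \<notin> A" "\<And>i. i \<ge> N \<Longrightarrow> \<alpha> (- i) \<notin> A"
      by (auto simp: ends_in_def)
    have "range \<alpha> \<inter> A \<subseteq> \<alpha> ` {- N..M}"
    proof clarify
      fix i assume i: "\<alpha> i \<in> A"
      have "i \<le> M" using MN(1)[of i] i by force
      moreover have "- i \<le> N" using MN(2)[of "- i"] i by force
      ultimately show "\<alpha> i \<in> \<alpha> ` {- N..M}" by auto
    qed
    then show False using inf by (meson finite_atLeastAtMost_int finite_imageI finite_subset)
  qed
qed

text \<open>Each ray finally stays on one side of \<open>A\<close>, so separating means that the two
  rays choose different sides. This reduces questions about corners to propositional logic.\<close>

lemma separators_iff:
  assumes \<alpha>: "bi_inf_path G \<alpha>" and A: "A \<subseteq> pverts G" "finite (boundary G A)"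
  shows "A \<in> separators \<alpha> \<longleftrightarrow> ends_in \<alpha> A \<noteq> ends_in (\<alpha> \<circ> uminus) A"
proof -
  have "A \<in> separators \<alpha> \<longleftrightarrow> infinite (range \<alpha> \<inter> A) \<and> infinite (range \<alpha> \<inter> compl_in G A)"
    using A unfolding separators_def by blast
  moreover have "infinite (range \<alpha> \<inter> compl_in G A) \<longleftrightarrow> \<not> ends_in \<alpha> A \<or> \<not> ends_in (\<alpha> \<circ> uminus) A"
    using infinite_range_Int_iff[OF \<alpha>, of "compl_in G A"] A
      ends_in_compl[OF \<alpha> A] ends_in_compl[OF bi_inf_path_reverse[OF \<alpha>] A] by simp
  ultimately show ?thesis using infinite_range_Int_iff[OF \<alpha> A] by blast
qed

lemma separators_reverse: "separators (\<alpha> \<circ> uminus) = separators \<alpha>"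
  unfolding separators_def range_comp_uminus ..

definition min_separators :: "(int \<Rightarrow> 'a) \<Rightarrow> 'a set set" where
  "min_separators \<alpha> = {A \<in> separators \<alpha>. \<forall>B\<in>separators \<alpha>. card (boundary G A) \<le> card (boundary G B)}"

lemma min_separatorsD:
  assumes "A \<in> min_separators \<alpha>"
  shows "A \<in> separators \<alpha>" "A \<subseteq> pverts G" "finite (boundary G A)"
    "B \<in> separators \<alpha> \<Longrightarrow> card (boundary G A) \<le> card (boundary G B)"
  using assms unfolding min_separators_def separators_def by blast+

lemma min_separatorsI:
  assumes "A \<in> separators \<alpha>"
    and "\<And>B. B \<in> separators \<alpha> \<Longrightarrow> card (boundary G A) \<le> card (boundary G B)"
  shows "A \<in> min_separators \<alpha>"
  using assms unfolding min_separators_def by blast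

text \<open>
  The component of \<open>A\<close> containing the forward ray also separates, and its boundary is strictly
  smaller unless it is all of \<open>A\<close>.
\<close>

lemma conn_set_min_separator_aux:
  assumes \<alpha>: "bi_inf_path G \<alpha>" and A: "A \<in> min_separators \<alpha>" and "ends_in \<alpha> A"
  shows "conn_set (parcs G) A"
proof -
  obtain N where N: "\<And>i. i \<ge> N \<Longrightarrow> \<alpha> i \<in> A" using assms(3) by (auto simp: ends_in_def)
  have sep_A: "A \<in> separators \<alpha>" and A_sub: "A \<subseteq> pverts G" "finite (boundary G A)"
    using min_separatorsD[OF A] by blast+
  define X where "X = {x. (\<alpha> N, x) \<in> rtrancl_on A (parcs G)}"
  have XA: "X \<subseteq> A" using in_rtrancl_on_in_F by (fastforce simp: X_def)
  have X_step: "y \<in> X" if "x \<in> X" "(x, y) \<in> parcs G" "y \<in> A" for x y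
    using that by (auto simp: X_def intro: rtrancl_on_into_rtrancl_on)
  have ray: "\<alpha> i \<in> X" if "i \<ge> N" for i
    using that
  proof (induction i rule: int_ge_induct)
    case base
    then show ?case using N by (auto simp: X_def)
  next
    case (step i)
    then show ?case
      using X_step[of "\<alpha> i" "\<alpha> (i + 1)"] \<alpha> N[of "i + 1"] by (simp add: bi_inf_path_def)
  qed
  have bd: "boundary G X \<subseteq> boundary G A"
    using XA X_step by (auto simp: boundary_def)
  have "\<not> ends_in (\<alpha> \<circ> uminus) A"
    using sep_A assms(3) separators_iff[OF \<alpha> A_sub] by blast
  then have "\<not> ends_in (\<alpha> \<circ> uminus) X" using XA by (auto simp: ends_in_def)
  moreover have "ends_in \<alpha> X" using ray by (auto simp: ends_in_def)
  ultimately have "X \<in> separators \<alpha>"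
    using separators_iff[OF \<alpha>, of X] XA A_sub bd finite_subset by blast
  then have "card (boundary G A) \<le> card (boundary G X)"
    by (rule min_separatorsD(4)[OF A])
  then have eq: "boundary G X = boundary G A"
    using bd A_sub(2) by (simp add: card_seteq)
  \<comment> \<open>By equality of the boundaries every arc leaving \<open>A\<close> starts in
    \<open>X\<close>, and no arc joins \<open>A - X\<close> to \<open>X\<close>. Connectedness of
    \<open>G\<close> then forces \<open>A - X = {}\<close>, as \<open>\<alpha> N\<close> lies
    outside \<open>A - X\<close>.\<close>
  have "boundary G (A - X) = {}"
  proof -
    have False if xy: "(x, y) \<in> parcs G" "x \<in> A - X" "y \<in> compl_in G (A - X)" for x y
    proof (cases "y \<in> A")
      case True
      then show False using X_step[of y x] xy parcs_sym by blast
    next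
      case False
      then have "(x, y) \<in> boundary G A" using xy by (auto simp: boundary_def)
      then show False using xy eq by (auto simp: boundary_def)
    qed
    then show ?thesis by (auto simp: boundary_def)
  qed
  moreover have "\<alpha> N \<in> X" using ray by simp
  ultimately have "A - X = {}"
    using boundary_empty_iff[of "A - X"] A_sub(1) XA by blast
  then have "A = X" using XA by blast
  moreover have "(u, v) \<in> rtrancl_on A (parcs G)" if "u \<in> X" "v \<in> X" for u v
  proof -
    have "sym (rtrancl_on A (parcs G))" using parcs_sym by (intro rtrancl_on_sym) (auto simp: sym_def)
    then show ?thesis using that unfolding X_def by (auto dest: symD intro: rtrancl_on_trans)
  qed
  ultimately show ?thesis by (simp add: conn_set_def)
qed

lemma min_separators_compl:
  assumes A: "A \<in> min_separators \<alpha>"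
  shows "compl_in G A \<in> min_separators \<alpha>"
proof (rule min_separatorsI)
  show "compl_in G A \<in> separators \<alpha>"
    by (rule separators_compl[OF min_separatorsD(1)[OF A]])
  show "card (boundary G (compl_in G A)) \<le> card (boundary G B)" if "B \<in> separators \<alpha>" for B
    using min_separatorsD(2,4)[OF A] that by simp
qed

text \<open>Each side contains a tail of the forward or of the backward ray, and reversing the path
  preserves minimality. So the connectedness argument above applies to both sides.\<close>

lemma min_separator_is_cut:
  assumes \<alpha>: "bi_inf_path G \<alpha>" and A: "A \<in> min_separators \<alpha>"
  shows "is_cut G A"
proof -
  have conn: "conn_set (parcs G) B" if "B \<in> min_separators \<alpha>" for B
  proof (cases "ends_in \<alpha> B")
    case True
    then show ?thesis using conn_set_min_separator_aux \<alpha> that by blast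
  next
    case False
    have B: "B \<in> separators \<alpha>" "B \<subseteq> pverts G" "finite (boundary G B)"
      using min_separatorsD[OF that] by blast+
    then have "ends_in (\<alpha> \<circ> uminus) B" using separators_iff[OF \<alpha> B(2,3)] False by blast
    moreover have "B \<in> min_separators (\<alpha> \<circ> uminus)"
      using that unfolding min_separators_def separators_reverse .
    ultimately show ?thesis
      using conn_set_min_separator_aux bi_inf_path_reverse[OF \<alpha>] by blast
  qed
  have "A \<subseteq> pverts G \<and> A \<noteq> {} \<and> compl_in G A \<noteq> {} \<and> finite (boundary G A)"
    using min_separatorsD(1)[OF A] by (auto simp: separators_def)
  then show ?thesis using conn A min_separators_compl by (simp add: is_cut_iff)
qed

text \<open>A separator with least boundary is itself a cut, so the minimum over cuts equals that
  over all separators.\<close>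

lemma cuts_min_eq:
  assumes \<alpha>: "bi_inf_path G \<alpha>"
  shows "cuts_min G \<alpha> = min_separators \<alpha>"
proof
  show "min_separators \<alpha> \<subseteq> cuts_min G \<alpha>"
  proof
    fix C assume C: "C \<in> min_separators \<alpha>"
    then have "C \<in> cuts G \<alpha>"
      using min_separator_is_cut[OF \<alpha> C] min_separatorsD(1) by (simp add: cuts_eq)
    moreover have "card (boundary G C) \<le> card (boundary G D)" if "D \<in> cuts G \<alpha>" for D
      using min_separatorsD(4)[OF C] that by (simp add: cuts_eq)
    ultimately show "C \<in> cuts_min G \<alpha>"
      by (simp add: cuts_min_def is_arg_min_linorder)
  qed
  show "cuts_min G \<alpha> \<subseteq> min_separators \<alpha>"
  proof
    fix C assume C: "C \<in> cuts_min G \<alpha>"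
    then have sep: "C \<in> separators \<alpha>"
      by (simp add: cuts_min_def is_arg_min_linorder cuts_eq)
    then obtain B where B: "B \<in> min_separators \<alpha>"
      using ex_has_least_nat[of "\<lambda>A. A \<in> separators \<alpha>" C "\<lambda>A. card (boundary G A)"]
      unfolding min_separators_def by blast
    then have "B \<in> cuts G \<alpha>"
      using min_separator_is_cut[OF \<alpha>] min_separatorsD(1) by (simp add: cuts_eq)
    then have "card (boundary G C) \<le> card (boundary G B)"
      using C by (simp add: cuts_min_def is_arg_min_linorder)
    then show "C \<in> min_separators \<alpha>"
      using sep min_separatorsD(4)[OF B] by (blast intro: min_separatorsI order_trans)
  qed
qed

section \<open>Optimal cuts are nested\<close>

lemma crossing_number_compl:
  assumes "C \<subseteq> pverts G"
  shows "crossing_number G k (compl_in G C) = crossing_number G k C"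
  by (simp add: crossing_number_def nested_compl_left[OF assms])

text \<open>Strictness comes from \<open>C\<close>, which crosses \<open>D\<close> but neither corner.\<close>

lemma crossing_number_corners:
  assumes C: "is_kcut G k C" and D: "is_kcut G k D" and "\<not> nested G C D"
  shows "crossing_number G k (C \<inter> D) + crossing_number G k (C \<union> D)
    < crossing_number G k C + crossing_number G k D"
proof -
  let ?X = "\<lambda>C. {E. is_kcut G k E \<and> \<not> nested G C E}"
  have sub: "C \<subseteq> pverts G" "D \<subseteq> pverts G" using C D by (auto simp: is_kcut_def is_cut_iff)
  have subE: "E \<subseteq> pverts G" if "is_kcut G k E" for E
    using that by (auto simp: is_kcut_def is_cut_iff)
  have fin: "finite (?X C)" "finite (?X D)"
    using C D finite_crossing by (auto simp: is_kcut_def)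
  have C_in: "C \<in> ?X D" using C assms(3) nested_commute[OF sub] by simp
  have C_notin: "C \<notin> ?X (C \<inter> D)" "C \<notin> ?X (C \<union> D)"
    using sub by (auto simp: nested_def)
  have union: "?X (C \<inter> D) \<union> ?X (C \<union> D) \<subseteq> ?X C \<union> ?X D"
    using nested_corners[OF sub subE assms(3)] by blast
  have inter: "?X (C \<inter> D) \<inter> ?X (C \<union> D) \<subseteq> ?X C \<inter> ?X D"
    using nested_some_corner[OF sub subE] nested_some_corner[OF sub(2,1) subE]
    by (auto simp: Int_commute Un_commute)
  have "card (?X (C \<inter> D)) + card (?X (C \<union> D)) < card (?X C) + card (?X D)"
  proof -
    have "C \<notin> ?X C" by (auto simp: nested_def)
    \<comment> \<open>Removing \<open>C\<close> from \<open>?X D\<close> keeps both inclusions, as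
      \<open>C\<close> lies in neither corner set.\<close>
    then have "card (?X (C \<inter> D)) + card (?X (C \<union> D)) \<le> card (?X C) + card (?X D - {C})"
      by (intro card_add_le_card_add) (use fin union inter C_notin in blast)+
    also have "\<dots> < card (?X C) + card (?X D)"
      using card_Diff1_less[OF fin(2) C_in] by simp
    finally show ?thesis .
  qed
  then show ?thesis by (simp add: crossing_number_def)
qed

end

locale accessible_pair_graph = connected_pair_graph +
  fixes k :: nat
  assumes accessible_k: "accessible_with G k"
begin

lemma cuts_opt_path_iff:
  assumes "bi_inf_path G \<alpha>"
  shows "C \<in> cuts_opt_path G k \<alpha> \<longleftrightarrow> C \<in> min_separators \<alpha> \<and>
    (\<forall>D\<in>min_separators \<alpha>. crossing_number G k C \<le> crossing_number G k D)"
  by (auto simp: cuts_opt_path_def is_arg_min_linorder cuts_min_eq[OF assms])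

lemma min_separator_is_kcut:
  assumes \<alpha>: "bi_inf_path G \<alpha>" and C: "C \<in> min_separators \<alpha>"
  shows "is_kcut G k C"
proof -
  have cut: "is_cut G C" using assms by (rule min_separator_is_cut)
  then have "C \<in> cuts G \<alpha>" using C by (simp add: cuts_eq min_separators_def)
  then obtain B where "B \<in> cuts G \<alpha>" "is_kcut G k B"
    using accessible_k \<alpha> by (auto simp: accessible_with_def)
  then have "card (boundary G C) \<le> k"
    using C by (force simp: cuts_eq min_separators_def is_kcut_def)
  then show ?thesis using cut by (simp add: is_kcut_def)
qed

lemma cuts_opt_path_compl:
  assumes \<alpha>: "bi_inf_path G \<alpha>" and C: "C \<in> cuts_opt_path G k \<alpha>"
  shows "compl_in G C \<in> cuts_opt_path G k \<alpha>"
proof -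
  have "C \<subseteq> pverts G"
    using C by (auto simp: cuts_opt_path_iff[OF \<alpha>] min_separators_def separators_def)
  then show ?thesis
    using C min_separators_compl by (simp add: cuts_opt_path_iff[OF \<alpha>] crossing_number_compl)
qed

text \<open>
  By submodularity both corners are minimal separators, so their crossing numbers are at least those
  of \<open>D\<close> and \<open>C\<close>, against \<open>crossing_number_corners\<close>.
\<close>

lemma nested_if_corners_separate:
  assumes \<alpha>: "bi_inf_path G \<alpha>" and \<beta>: "bi_inf_path G \<beta>"
    and C: "C \<in> cuts_opt_path G k \<alpha>" and D: "D \<in> cuts_opt_path G k \<beta>"
    and corners: "C \<inter> D \<in> separators \<alpha>" "C \<union> D \<in> separators \<beta>"
  shows "nested G C D"
proof (rule ccontr)
  assume "\<not> nested G C D"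
  moreover have min: "C \<in> min_separators \<alpha>" "D \<in> min_separators \<beta>"
    using C D by (auto simp: cuts_opt_path_iff[OF \<alpha>] cuts_opt_path_iff[OF \<beta>])
  ultimately have less: "crossing_number G k (C \<inter> D) + crossing_number G k (C \<union> D)
      < crossing_number G k C + crossing_number G k D"
    using crossing_number_corners min_separator_is_kcut \<alpha> \<beta> by blast
  have "card (boundary G (C \<inter> D)) + card (boundary G (C \<union> D))
      \<le> card (boundary G C) + card (boundary G D)"
    using min by (intro card_boundary_submodular) (auto simp: min_separators_def separators_def)
  moreover have ge: "card (boundary G C) \<le> card (boundary G (C \<inter> D))"
      "card (boundary G D) \<le> card (boundary G (C \<union> D))"
    using min corners by (auto simp: min_separators_def)
  ultimately have "card (boundary G (C \<inter> D)) = card (boundary G C)"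
      "card (boundary G (C \<union> D)) = card (boundary G D)"
    by linarith+
  then have "C \<inter> D \<in> min_separators \<alpha>" "C \<union> D \<in> min_separators \<beta>"
    using min corners by (auto simp: min_separators_def)
  then have "crossing_number G k C \<le> crossing_number G k (C \<inter> D)"
      "crossing_number G k D \<le> crossing_number G k (C \<union> D)"
    using C D by (auto simp: cuts_opt_path_iff[OF \<alpha>] cuts_opt_path_iff[OF \<beta>])
  then show False using less by linarith
qed

text \<open>Each cut competes for the other's path, so the two agree first in boundary size and then
  in crossing number.\<close>

lemma cuts_opt_path_swap:
  assumes \<alpha>: "bi_inf_path G \<alpha>" and \<beta>: "bi_inf_path G \<beta>"
    and C: "C \<in> cuts_opt_path G k \<alpha>" and D: "D \<in> cuts_opt_path G k \<beta>"
    and "D \<in> separators \<alpha>" "C \<in> separators \<beta>"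
  shows "D \<in> cuts_opt_path G k \<alpha>"
proof -
  have min: "C \<in> min_separators \<alpha>" "D \<in> min_separators \<beta>"
    using C D by (auto simp: cuts_opt_path_iff[OF \<alpha>] cuts_opt_path_iff[OF \<beta>])
  then have "card (boundary G C) = card (boundary G D)"
    using assms(5,6) by (auto simp: min_separators_def intro: order_antisym)
  then have min': "D \<in> min_separators \<alpha>" "C \<in> min_separators \<beta>"
    using min assms(5,6) by (auto simp: min_separators_def)
  then have "crossing_number G k D = crossing_number G k C"
    using C D by (auto simp: cuts_opt_path_iff[OF \<alpha>] cuts_opt_path_iff[OF \<beta>] intro: order_antisym)
  then show ?thesis using C min' by (simp add: cuts_opt_path_iff[OF \<alpha>])
qed

text \<open>The last two assumptions express through rays that \<open>X \<inter> Y\<close> separates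
  \<open>\<alpha>\<close> and \<open>X \<union> Y\<close> separates \<open>\<beta>\<close>. In this
  form the choice of the sides \<open>X\<close> and \<open>Y\<close> is purely
  propositional.\<close>

lemma nested_if_meeting_corners:
  assumes \<alpha>: "bi_inf_path G \<alpha>" and \<beta>: "bi_inf_path G \<beta>"
    and C: "C \<in> cuts_opt_path G k \<alpha>" and D: "D \<in> cuts_opt_path G k \<beta>"
    and X: "X \<in> {C, compl_in G C}" and Y: "Y \<in> {D, compl_in G D}"
    and "(ends_in \<alpha> X \<and> ends_in \<alpha> Y) \<noteq> (ends_in (\<alpha> \<circ> uminus) X \<and> ends_in (\<alpha> \<circ> uminus) Y)"
    and "(ends_in \<beta> X \<or> ends_in \<beta> Y) \<noteq> (ends_in (\<beta> \<circ> uminus) X \<or> ends_in (\<beta> \<circ> uminus) Y)"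
  shows "nested G C D"
proof -
  have sub: "C \<subseteq> pverts G" "D \<subseteq> pverts G" "finite (boundary G C)" "finite (boundary G D)"
    using C D by (auto simp: cuts_opt_path_iff[OF \<alpha>] cuts_opt_path_iff[OF \<beta>]
        min_separators_def separators_def)
  have subXY: "X \<subseteq> pverts G" "Y \<subseteq> pverts G" "finite (boundary G X)" "finite (boundary G Y)"
    using X Y sub by auto
  have fin: "finite (boundary G (X \<inter> Y))" "finite (boundary G (X \<union> Y))"
    by (rule finite_subset[of _ "boundary G X \<union> boundary G Y"];
        use subXY in \<open>auto simp: boundary_def\<close>)+
  have ends_Un: "ends_in \<gamma> (X \<union> Y) \<longleftrightarrow> ends_in \<gamma> X \<or> ends_in \<gamma> Y" if \<gamma>: "bi_inf_path G \<gamma>" for \<gamma>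
    using ends_in_Int[of \<gamma> "compl_in G X" "compl_in G Y"] subXY fin
    by (simp add: Diff_Un[symmetric] ends_in_compl[OF \<gamma>]) blast
  have "X \<inter> Y \<in> separators \<alpha>"
    using separators_iff[OF \<alpha>, of "X \<inter> Y"] subXY fin assms(7) by (auto simp: ends_in_Int)
  moreover have "X \<union> Y \<in> separators \<beta>"
    using separators_iff[OF \<beta>, of "X \<union> Y"] subXY fin assms(8)
      ends_Un[OF \<beta>] ends_Un[OF bi_inf_path_reverse[OF \<beta>]] by auto
  moreover have "X \<in> cuts_opt_path G k \<alpha>" "Y \<in> cuts_opt_path G k \<beta>"
    using X Y C D cuts_opt_path_compl \<alpha> \<beta> by auto
  ultimately have "nested G X Y" using nested_if_corners_separate \<alpha> \<beta> by blast
  then show ?thesis using X Y sub by (auto simp: nested_compl_left nested_compl_right)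
qed

lemma cuts_opt_path_nested:
  assumes \<alpha>: "bi_inf_path G \<alpha>" and \<beta>: "bi_inf_path G \<beta>"
    and C: "C \<in> cuts_opt_path G k \<alpha>" and D: "D \<in> cuts_opt_path G k \<beta>"
  shows "nested G C D"
proof -
  have sub: "C \<subseteq> pverts G" "D \<subseteq> pverts G" "finite (boundary G C)" "finite (boundary G D)"
    and sep: "C \<in> separators \<alpha>" "D \<in> separators \<beta>"
    using C D by (auto simp: cuts_opt_path_iff[OF \<alpha>] cuts_opt_path_iff[OF \<beta>]
        min_separators_def separators_def)
  note ends = ends_in_compl[OF \<alpha> sub(1,3)] ends_in_compl[OF \<alpha> sub(2,4)]
    ends_in_compl[OF bi_inf_path_reverse[OF \<alpha>] sub(1,3)]
    ends_in_compl[OF bi_inf_path_reverse[OF \<alpha>] sub(2,4)]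
    ends_in_compl[OF \<beta> sub(1,3)] ends_in_compl[OF \<beta> sub(2,4)]
    ends_in_compl[OF bi_inf_path_reverse[OF \<beta>] sub(1,3)]
    ends_in_compl[OF bi_inf_path_reverse[OF \<beta>] sub(2,4)]
  note corners = nested_if_meeting_corners[OF \<alpha> \<beta> C D, of C D]
    nested_if_meeting_corners[OF \<alpha> \<beta> C D, of C "compl_in G D"]
    nested_if_meeting_corners[OF \<alpha> \<beta> C D, of "compl_in G C" D]
    nested_if_meeting_corners[OF \<alpha> \<beta> C D, of "compl_in G C" "compl_in G D"]
  have C_\<alpha>: "ends_in \<alpha> C \<noteq> ends_in (\<alpha> \<circ> uminus) C"
    and D_\<beta>: "ends_in \<beta> D \<noteq> ends_in (\<beta> \<circ> uminus) D"
    using sep separators_iff[OF \<alpha> sub(1,3)] separators_iff[OF \<beta> sub(2,4)] by auto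
  show ?thesis
  proof (cases "D \<in> separators \<alpha> \<and> C \<in> separators \<beta>")
    case True
    then have D': "D \<in> cuts_opt_path G k \<alpha>" using cuts_opt_path_swap[OF \<alpha> \<beta> C D] by blast
    \<comment> \<open>Both cuts now separate \<open>\<alpha>\<close>. With \<open>X = C\<close>, let
      \<open>Y\<close> be the side of \<open>D\<close> holding the same ray of
      \<open>\<alpha>\<close>: the intersection holds that ray and the union misses the
      other.\<close>
    have "ends_in \<alpha> D \<noteq> ends_in (\<alpha> \<circ> uminus) D"
      using True separators_iff[OF \<alpha> sub(2,4)] by auto
    then show ?thesis
      using nested_if_meeting_corners[OF \<alpha> \<alpha> C D', of C D]
        nested_if_meeting_corners[OF \<alpha> \<alpha> C D', of C "compl_in G D"]
        C_\<alpha> ends(1-4) by simp blast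
  next
    case False
    then have "ends_in \<alpha> D = ends_in (\<alpha> \<circ> uminus) D \<or> ends_in \<beta> C = ends_in (\<beta> \<circ> uminus) C"
      using separators_iff[OF \<alpha> sub(2,4)] separators_iff[OF \<beta> sub(1,3)] by auto
    \<comment> \<open>If \<open>D\<close> does not separate \<open>\<alpha>\<close>, let
      \<open>Y\<close> be the side of \<open>D\<close> holding both rays of \<open>\<alpha>\<close>,
      and \<open>X\<close> the side of \<open>C\<close> avoiding the ray of \<open>\<beta>\<close>
      outside \<open>Y\<close>. If \<open>C\<close> does not separate \<open>\<beta>\<close>, let
      \<open>X\<close> avoid both rays of \<open>\<beta>\<close>, and let \<open>Y\<close> hold the
      ray of \<open>\<alpha>\<close> that \<open>X\<close> holds.\<close>
    then show ?thesis
      using corners C_\<alpha> D_\<beta> ends by simp argo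
  qed
qed

lemma cuts_optE:
  assumes "C \<in> cuts_opt G k"
  obtains \<alpha> where "bi_inf_path G \<alpha>" "C \<in> cuts_opt_path G k \<alpha>"
  using assms by (auto simp: cuts_opt_def)

lemma cuts_opt_nested: "C \<in> cuts_opt G k \<Longrightarrow> D \<in> cuts_opt G k \<Longrightarrow> nested G C D"
  by (meson cuts_optE cuts_opt_path_nested)

lemma cuts_opt_compl: "C \<in> cuts_opt G k \<Longrightarrow> compl_in G C \<in> cuts_opt G k"
  using cuts_opt_path_compl by (fastforce simp: cuts_opt_def)

lemma cuts_opt_is_kcut: "C \<in> cuts_opt G k \<Longrightarrow> is_kcut G k C"
  by (meson cuts_optE cuts_opt_path_iff min_separator_is_kcut)

end

section \<open>The graph of a nested set of small cuts is a tree\<close>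

lemma (in pre_digraph) cas_nth_Suc:
  "cas u p v \<Longrightarrow> Suc i < length p \<Longrightarrow> tail G (p ! Suc i) = head G (p ! i)"
proof (induction p arbitrary: u i)
  case (Cons e p)
  then show ?case by (cases i; cases p) auto
qed simp

lemma (in pre_digraph) cas_hd: "cas u p v \<Longrightarrow> p \<noteq> [] \<Longrightarrow> tail G (hd p) = u"
  by (cases p) auto

lemma (in pre_digraph) cas_last: "cas u p v \<Longrightarrow> p \<noteq> [] \<Longrightarrow> head G (last p) = v"
  by (induction p arbitrary: u) auto

text \<open>Optimality enters the tree argument only through these three properties.\<close>

locale nested_cuts = connected_pair_graph +
  fixes \<C> :: "'a set set" and k :: nat
  assumes is_kcut: "C \<in> \<C> \<Longrightarrow> is_kcut G k C"
    and compl_closed: "C \<in> \<C> \<Longrightarrow> compl_in G C \<in> \<C>"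
    and nested_\<C>: "C \<in> \<C> \<Longrightarrow> D \<in> \<C> \<Longrightarrow> nested G C D"
begin

lemma cutD:
  assumes "C \<in> \<C>"
  shows "C \<subseteq> pverts G" "C \<noteq> {}" "compl_in G C \<noteq> {}" "compl_in G (compl_in G C) = C"
  using is_kcut[OF assms] by (auto simp: is_kcut_def is_cut_iff double_diff)

lemma compl_neq: "C \<in> \<C> \<Longrightarrow> compl_in G C \<noteq> C"
  using cutD(2) by blast

section \<open>The equivalence relation on nested cuts\<close>

lemma cut_relI:
  assumes "C \<in> \<C>" "D \<in> \<C>" "compl_in G C \<subset> D"
    and "\<And>E. E \<in> \<C> \<Longrightarrow> compl_in G C \<subset> E \<Longrightarrow> E \<subseteq> D \<Longrightarrow> E = D"
  shows "(C, D) \<in> cut_rel G \<C>"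
  using assms unfolding cut_rel_def by blast

lemma cut_relE:
  assumes "(C, D) \<in> cut_rel G \<C>"
  obtains (eq) "C \<in> \<C>" "D = C"
  | (less) "C \<in> \<C>" "D \<in> \<C>" "compl_in G C \<subset> D"
      "\<And>E. E \<in> \<C> \<Longrightarrow> compl_in G C \<subset> E \<Longrightarrow> E \<subseteq> D \<Longrightarrow> E = D"
  using assms unfolding cut_rel_def by blast

text \<open>Complements reverse inclusions: a set \<open>E\<close> between
  \<open>compl_in G D\<close> and \<open>C\<close> yields \<open>compl_in G E\<close> between
  \<open>compl_in G C\<close> and \<open>D\<close>, with the strict and the non-strict inclusion
  exchanged. For \<open>E \<noteq> C\<close> both would be strict, against the minimality of
  \<open>D\<close>.\<close>

lemma cut_rel_sym:
  assumes "(C, D) \<in> cut_rel G \<C>"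
  shows "(D, C) \<in> cut_rel G \<C>"
  using assms
proof (cases rule: cut_relE)
  case eq
  then show ?thesis using assms by simp
next
  case less
  note C = cutD[OF less(1)] and D = cutD[OF less(2)]
  show ?thesis
  proof (rule cut_relI)
    show "compl_in G D \<subset> C" using less(3) C(1) D(1) by blast
    fix E assume E: "E \<in> \<C>" "compl_in G D \<subset> E" "E \<subseteq> C"
    note E' = cutD[OF E(1)]
    have "compl_in G E \<subset> D" using E(2) D(1) E'(1) by blast
    then have "\<not> compl_in G C \<subset> compl_in G E"
      using less(4)[OF compl_closed[OF E(1)]] by blast
    then show "E = C" using E(3) E'(1) C(1) by blast
  qed (use less in auto)
qed

lemma cut_rel_trans:
  assumes CD: "(C, D) \<in> cut_rel G \<C>" and DE: "(D, E) \<in> cut_rel G \<C>"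
  shows "(C, E) \<in> cut_rel G \<C>"
proof (cases "C = D \<or> D = E \<or> C = E")
  case True
  have "C \<in> \<C>" using CD by (auto elim: cut_relE)
  then have "(C, C) \<in> cut_rel G \<C>" by (simp add: cut_rel_def)
  then show ?thesis using True assms by auto
next
  case False
  note ne = this
  have mem: "C \<in> \<C>" "D \<in> \<C>" "E \<in> \<C>" using assms by (auto elim: cut_relE)
  have min_CD: "F = D" if "F \<in> \<C>" "compl_in G C \<subset> F" "F \<subseteq> D" for F
    using CD ne that by (auto elim: cut_relE)
  have min_DE: "F = E" if "F \<in> \<C>" "compl_in G D \<subset> F" "F \<subseteq> E" for F
    using DE ne that by (auto elim: cut_relE)
  have min_DC: "F = C" if "F \<in> \<C>" "compl_in G D \<subset> F" "F \<subseteq> C" for F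
    using cut_rel_sym[OF CD] ne that by (auto elim: cut_relE)
  have CD': "compl_in G C \<subset> D" using CD ne by (auto elim: cut_relE)
  have DE': "compl_in G D \<subset> E" using DE ne by (auto elim: cut_relE)
  have DC': "compl_in G D \<subset> C" using cut_rel_sym[OF CD] ne by (auto elim: cut_relE)
  note C = cutD[OF mem(1)] and D = cutD[OF mem(2)] and E = cutD[OF mem(3)]
  \<comment> \<open>Of the four ways to be nested only \<open>compl_in G C \<subseteq> E\<close>
    survives: \<open>C\<close> and \<open>E\<close> share the non-empty \<open>compl_in G D\<close>,
    and an inclusion between them would force \<open>C = E\<close> by minimality.\<close>
  have "\<not> C \<subseteq> compl_in G E" using DC' DE' D(3) by blast
  moreover have "\<not> C \<subseteq> E" using min_DE[OF mem(1) DC'] ne by blast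
  moreover have "\<not> E \<subseteq> C" using min_DC[OF mem(3) DE'] ne by blast
  then have "\<not> compl_in G C \<subseteq> compl_in G E" using E(1) C(1) by blast
  ultimately have CE: "compl_in G C \<subseteq> E"
    using nested_\<C>[OF mem(1,3)] by (auto simp: nested_def)
  show ?thesis
  proof (rule cut_relI)
    show "compl_in G C \<subset> E" using CE DC' DE' D(3) by blast
    fix F assume F: "F \<in> \<C>" "compl_in G C \<subset> F" "F \<subseteq> E"
    \<comment> \<open>Three of the four nestings of \<open>D\<close> and \<open>F\<close> fail:
      \<open>D \<subseteq> F\<close> would make \<open>E\<close> everything,
      \<open>F \<subseteq> D\<close> would give \<open>F = D\<close>, and \<open>D\<close> and
      \<open>F\<close> share \<open>compl_in G C\<close>. The last one puts \<open>F\<close> between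
      \<open>compl_in G D\<close> and \<open>E\<close>.\<close>
    have "\<not> D \<subseteq> F" using F(3) DE' E(1,3) by blast
    moreover have "\<not> F \<subseteq> D"
      using min_CD[OF F(1,2)] \<open>\<not> D \<subseteq> F\<close> by blast
    then have "\<not> compl_in G D \<subseteq> compl_in G F" using cutD(1)[OF F(1)] D(1) by blast
    moreover have "\<not> D \<subseteq> compl_in G F" using CD' F(2) C(3) by blast
    ultimately have "compl_in G D \<subseteq> F"
      using nested_\<C>[OF mem(2) F(1)] by (auto simp: nested_def)
    moreover have "compl_in G D \<noteq> F" using F(2) CD' C(3) by blast
    ultimately show "F = E" using min_DE[OF F(1)] F(3) by blast
  qed (use mem in auto)
qed

lemma equiv_cut_rel: "equiv \<C> (cut_rel G \<C>)"
proof (rule equivI)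
  show "refl_on \<C> (cut_rel G \<C>)" by (auto simp: refl_on_def cut_rel_def)
  show "sym (cut_rel G \<C>)" using cut_rel_sym by (blast intro: symI)
  show "trans (cut_rel G \<C>)" using cut_rel_trans by (blast intro: transI)
  show "cut_rel G \<C> \<subseteq> \<C> \<times> \<C>" by (auto simp: cut_rel_def)
qed

section \<open>The cut graph: connectedness and absence of cycles\<close>

abbreviation T :: "('a set set, 'a set \<times> 'a set) pre_digraph" where
  "T \<equiv> cut_graph G \<C>"

abbreviation cls :: "'a set \<Rightarrow> 'a set set" where
  "cls C \<equiv> cut_rel G \<C> `` {C}"

lemma cls_eq_iff: "C \<in> \<C> \<Longrightarrow> D \<in> \<C> \<Longrightarrow> cls C = cls D \<longleftrightarrow> (C, D) \<in> cut_rel G \<C>"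
  using eq_equiv_class_iff[OF equiv_cut_rel] by blast

lemma cls_in_verts: "C \<in> \<C> \<Longrightarrow> cls C \<in> verts T"
  by (simp add: cut_graph_def quotientI)

lemma cut_graph_simps:
  "verts T = \<C> // cut_rel G \<C>"
  "arcs T = {(C, compl_in G C) | C. C \<in> \<C>}"
  "tail T e = cls (fst e)"
  "head T e = cls (snd e)"
  by (simp_all add: cut_graph_def split_beta)

lemma cut_graph_arcE:
  assumes "e \<in> arcs T"
  obtains C where "C \<in> \<C>" "e = (C, compl_in G C)"
  using assms by (auto simp: cut_graph_simps(2))

lemma wf_cut_graph: "wf_digraph T"
proof (rule wf_digraph.intro)
  fix e assume "e \<in> arcs T"
  then obtain C where "C \<in> \<C>" "e = (C, compl_in G C)" by (rule cut_graph_arcE)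
  then show "tail T e \<in> verts T" "head T e \<in> verts T"
    using compl_closed cls_in_verts by (simp_all add: cut_graph_simps(3,4))
qed

lemma bidirected_cut_graph: "bidirected_digraph T (cut_graph_rev G \<C>)"
proof (rule wf_digraph.bidirected_digraphI[OF wf_cut_graph])
  fix e assume e: "e \<in> arcs T"
  then obtain C where C: "C \<in> \<C>" "e = (C, compl_in G C)" by (rule cut_graph_arcE)
  show "cut_graph_rev G \<C> e \<noteq> e"
    using e C compl_neq by (simp add: cut_graph_rev_def)
  have "prod.swap e = (compl_in G C, compl_in G (compl_in G C))"
    using C cutD(4) by simp
  then have "prod.swap e \<in> arcs T"
    using compl_closed[OF C(1)] unfolding cut_graph_simps(2) by blast
  then show "cut_graph_rev G \<C> (cut_graph_rev G \<C> e) = e"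
    using e by (simp add: cut_graph_rev_def)
  show "tail T (cut_graph_rev G \<C> e) = head T e"
    using e by (simp add: cut_graph_rev_def cut_graph_simps(3,4))
qed (simp add: cut_graph_rev_def)

lemmas cut_graph_reachable_trans = wf_digraph.reachable_trans[OF wf_cut_graph]

lemma reachable_compl: "C \<in> \<C> \<Longrightarrow> cls C \<rightarrow>\<^sup>*\<^bsub>T\<^esub> cls (compl_in G C)"
proof -
  assume C: "C \<in> \<C>"
  then have "(C, compl_in G C) \<in> arcs T" by (auto simp: cut_graph_simps)
  then have "cls C \<rightarrow>\<^bsub>T\<^esub> cls (compl_in G C)"
    by (force simp: arcs_ends_conv cut_graph_simps(3,4))
  then show ?thesis by (rule wf_digraph.reachable_adjI[OF wf_cut_graph])
qed

text \<open>The members between \<open>C\<close> and \<open>D\<close> are \<open>k\<close>-cuts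
  separating a vertex of \<open>C\<close> from one outside \<open>D\<close>, hence finitely many. A
  minimal one \<open>E\<close> strictly above \<open>C\<close> is equivalent to the complement of
  \<open>C\<close>, so the edge of \<open>C\<close> leads to the class of \<open>E\<close>, and
  induction continues from there.\<close>

lemma reachable_superset:
  assumes "C \<in> \<C>" "D \<in> \<C>" "C \<subseteq> D"
  shows "cls C \<rightarrow>\<^sup>*\<^bsub>T\<^esub> cls D"
  using assms
proof (induction "card {E \<in> \<C>. C \<subseteq> E \<and> E \<subseteq> D}" arbitrary: C rule: less_induct)
  case less
  note C = cutD[OF less.prems(1)] and D = cutD[OF less.prems(2)]
  have fin: "finite {E \<in> \<C>. C \<subseteq> E \<and> E \<subseteq> D}"
  proof -
    obtain u v where "u \<in> C" "v \<in> pverts G" "v \<notin> D" using C D by blast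
    moreover from this have "u \<in> pverts G" using C(1) by blast
    ultimately show ?thesis
      by (intro finite_subset[OF _ finite_kcuts_separating[of u v k]]) (auto simp: is_kcut)
  qed
  show ?case
  proof (cases "C = D")
    case True
    then show ?thesis using cls_in_verts[OF less.prems(2)] unfolding reachable_def
      by (simp only: rtrancl_on_refl)
  next
    case False
    let ?S = "{E \<in> \<C>. C \<subset> E \<and> E \<subseteq> D}"
    have "finite ?S" by (rule finite_subset[OF _ fin]) auto
    moreover have "?S \<noteq> {}" using False less.prems by blast
    ultimately have "\<exists>E\<in>?S. \<forall>F\<in>?S. F \<subseteq> E \<longrightarrow> E = F" by (rule finite_has_minimal)
    then obtain E where E_S: "E \<in> ?S" and E_min: "\<forall>F\<in>?S. F \<subseteq> E \<longrightarrow> E = F" ..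
    from E_S have E: "E \<in> \<C>" "C \<subset> E" "E \<subseteq> D" by simp_all
    have min: "F = E" if "F \<in> \<C>" "C \<subset> F" "F \<subseteq> E" for F
      using E_min that E(3) by blast
    have "(compl_in G C, E) \<in> cut_rel G \<C>"
      by (rule cut_relI) (use E(1,2) min compl_closed[OF less.prems(1)] in \<open>simp_all add: C(4)\<close>)
    then have "cls (compl_in G C) = cls E"
      using cls_eq_iff[OF compl_closed[OF less.prems(1)] E(1)] by blast
    then have "cls C \<rightarrow>\<^sup>*\<^bsub>T\<^esub> cls E" using reachable_compl[OF less.prems(1)] by simp
    moreover have "{F \<in> \<C>. E \<subseteq> F \<and> F \<subseteq> D} \<subset> {F \<in> \<C>. C \<subseteq> F \<and> F \<subseteq> D}"
      using E less.prems by blast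
    then have "cls E \<rightarrow>\<^sup>*\<^bsub>T\<^esub> cls D"
      by (rule less.hyps[OF psubset_card_mono[OF fin]]) (fact E less.prems(2))+
    ultimately show ?thesis by (rule cut_graph_reachable_trans)
  qed
qed

lemma conn_cut_graph: "conn T"
proof -
  have "cls C \<rightarrow>\<^sup>*\<^bsub>T\<^esub> cls D" if C: "C \<in> \<C>" and D: "D \<in> \<C>" for C D
  proof -
    have C': "cls C \<rightarrow>\<^sup>*\<^bsub>T\<^esub> cls (compl_in G C)" using reachable_compl[OF C] .
    have D': "cls (compl_in G D) \<rightarrow>\<^sup>*\<^bsub>T\<^esub> cls D"
      using reachable_compl[OF compl_closed[OF D]] cutD(4)[OF D] by simp
    consider "C \<subseteq> D" | "C \<subseteq> compl_in G D" | "compl_in G C \<subseteq> D" | "compl_in G C \<subseteq> compl_in G D"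
      using nested_\<C>[OF C D] by (auto simp: nested_def)
    then show ?thesis
    proof cases
      case 1
      then show ?thesis using reachable_superset C D by blast
    next
      case 2
      then show ?thesis using reachable_superset C D D' compl_closed cut_graph_reachable_trans by blast
    next
      case 3
      then show ?thesis using reachable_superset C D C' compl_closed cut_graph_reachable_trans by blast
    next
      case 4
      then have "cls (compl_in G C) \<rightarrow>\<^sup>*\<^bsub>T\<^esub> cls (compl_in G D)"
        using reachable_superset C D compl_closed by blast
      then show ?thesis using C' D' cut_graph_reachable_trans by blast
    qed
  qed
  then show ?thesis by (auto simp: conn_def cut_graph_simps(1) elim!: quotientE)
qed

text \<open>
  Along a walk without backtracking the first components of the arcs strictly increase.
\<close>

lemma no_ucycle: "\<not> ucycle T (cut_graph_rev G \<C>) p"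
proof
  assume "ucycle T (cut_graph_rev G \<C>) p"
  then have cycle: "pre_digraph.cycle T p" and not_rev: "\<And>e. p \<noteq> [e, cut_graph_rev G \<C> e]"
    unfolding ucycle_def by blast+
  from cycle obtain u where walk: "pre_digraph.awalk T u p u"
    and dist: "distinct (tl (pre_digraph.awalk_verts T u p))" and "p \<noteq> []"
    unfolding pre_digraph.cycle_def by (elim exE conjE)
  have cas: "pre_digraph.cas T u p u" and p_arcs: "set p \<subseteq> arcs T"
    using walk unfolding pre_digraph.awalk_def by simp_all
  define n where "n = length p - 1"
  have len: "length p = Suc n" using \<open>p \<noteq> []\<close> by (simp add: n_def)
  define c where "c i = fst (p ! i)" for i
  have p_nth: "p ! i = (c i, compl_in G (c i))" "c i \<in> \<C>" if "i \<le> n" for i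
  proof -
    have "p ! i \<in> set p" using that len by simp
    then have "p ! i \<in> arcs T" using p_arcs by blast
    then obtain C where "C \<in> \<C>" "p ! i = (C, compl_in G C)" by (rule cut_graph_arcE)
    then show "p ! i = (c i, compl_in G (c i))" "c i \<in> \<C>" by (simp_all add: c_def)
  qed
  have head: "head T (p ! i) = cls (compl_in G (c i))" and tail: "tail T (p ! i) = cls (c i)"
    if "i \<le> n" for i
    using p_nth[OF that] by (simp_all add: cut_graph_simps(3,4))
  have succ: "cls (compl_in G (c i)) = cls (c (Suc i))" if "Suc i \<le> n" for i
    using pre_digraph.cas_nth_Suc[OF cas, of i] head[of i] tail[of "Suc i"] that len by simp
  have wrap: "cls (compl_in G (c n)) = cls (c 0)"
  proof -
    have "hd p = p ! 0" "last p = p ! n"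
      using \<open>p \<noteq> []\<close> by (simp_all add: hd_conv_nth last_conv_nth n_def)
    then have "tail T (p ! 0) = u" "head T (p ! n) = u"
      using pre_digraph.cas_hd[OF cas \<open>p \<noteq> []\<close>] pre_digraph.cas_last[OF cas \<open>p \<noteq> []\<close>] by metis+
    then show ?thesis using head[OF order_refl] tail[OF le0] by metis
  qed
  \<comment> \<open>The vertices of a cycle are distinct apart from the return to \<open>u\<close>,
    so distinct positions have distinct heads.\<close>
  have inj: "i = j" if "i \<le> n" "j \<le> n" "cls (compl_in G (c i)) = cls (compl_in G (c j))" for i j
  proof -
    have "tl (pre_digraph.awalk_verts T u p) = map (head T) p"
      using pre_digraph.awalk_verts_conv'[OF cas] \<open>p \<noteq> []\<close> by simp
    then have "distinct (map (head T) p)" using dist by simp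
    moreover have "map (head T) p ! i = map (head T) p ! j"
      using that len by (simp add: head)
    ultimately show ?thesis
      using that len by (simp only: nth_eq_iff_index_eq length_map less_Suc_eq_le)
  qed
  \<comment> \<open>This is the walk back and forth along one edge, which \<open>ucycle\<close>
    excludes.\<close>
  have not_two: False if "n = 1" "c 1 = compl_in G (c 0)"
  proof -
    from len that(1) obtain a b where ab: "p = [a, b]" by (auto simp: length_Suc_conv)
    have "a = (c 0, compl_in G (c 0))" "b = (compl_in G (c 0), c 0)"
      using p_nth[of 0] p_nth[of 1] that ab cutD(4)[OF p_nth(2)[of 0]] by simp_all
    moreover have "a \<in> arcs T" using p_arcs ab by simp
    ultimately show False using not_rev[of a] ab by (simp add: cut_graph_rev_def)
  qed
  \<comment> \<open>The alternative to growth is backtracking, which returns to the class of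
    \<open>c i\<close>. That class is also the head of the cyclically preceding arc, so
    \<open>inj\<close> leaves only a cycle of two arcs.\<close>
  have step: "c i \<subset> c (Suc i)" if i: "Suc i \<le> n" for i
  proof -
    have "c (Suc i) \<noteq> compl_in G (c i)"
    proof
      assume eq: "c (Suc i) = compl_in G (c i)"
      then have returns: "cls (compl_in G (c (Suc i))) = cls (c i)"
        using cutD(4) p_nth(2)[of i] i by simp
      show False
      proof (cases i)
        case 0
        then have "cls (compl_in G (c n)) = cls (compl_in G (c 1))" using returns wrap by simp
        then have "n = 1" using inj[of n 1] i by simp
        then show False using not_two eq 0 by simp
      next
        case (Suc j)
        then have "cls (compl_in G (c j)) = cls (compl_in G (c (Suc i)))"
          using returns succ[of j] i by simp
        then show False using inj[of j "Suc i"] i Suc by simp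
      qed
    qed
    moreover have c_i: "c i \<in> \<C>" "c (Suc i) \<in> \<C>" using p_nth(2) i by simp_all
    have "(compl_in G (c i), c (Suc i)) \<in> cut_rel G \<C>"
      using succ[OF i] cls_eq_iff[OF compl_closed[OF c_i(1)] c_i(2)] by blast
    then have "c (Suc i) = compl_in G (c i) \<or> compl_in G (compl_in G (c i)) \<subset> c (Suc i)"
      by (cases rule: cut_relE) blast+
    ultimately show ?thesis unfolding cutD(4)[OF c_i(1)] by blast
  qed
  have mono: "c 0 \<subseteq> c i" if "i \<le> n" for i
    using that
  proof (induction i)
    case (Suc i)
    then show ?case using step[of i] by auto
  qed simp
  have c_0n: "c 0 \<in> \<C>" "c n \<in> \<C>" using p_nth(2) by simp_all
  \<comment> \<open>The same alternative at the base vertex: growth \<open>c n \<subset> c 0\<close>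
    contradicts \<open>mono\<close>, and backtracking leaves a single arc or two arcs, both
    impossible.\<close>
  have "(compl_in G (c n), c 0) \<in> cut_rel G \<C>"
    using wrap cls_eq_iff[OF compl_closed[OF c_0n(2)] c_0n(1)] by blast
  then have "c 0 = compl_in G (c n) \<or> compl_in G (compl_in G (c n)) \<subset> c 0"
    by (cases rule: cut_relE) blast+
  then have eq: "c 0 = compl_in G (c n)"
    using mono[OF order_refl] unfolding cutD(4)[OF c_0n(2)] by blast
  then have c_n: "c n = compl_in G (c 0)" using cutD(4)[OF c_0n(2)] by simp
  show False
  proof (cases n)
    case 0
    then show False using eq compl_neq[OF c_0n(1)] by simp
  next
    case (Suc m)
    then have "cls (compl_in G (c 0)) = cls (compl_in G (c m))"
      using succ[of m] c_n by simp
    then have "m = 0" using inj[of 0 m] Suc by simp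
    then show False using not_two c_n Suc by simp
  qed
qed

lemma utree_cut_graph: "utree T (cut_graph_rev G \<C>)"
  using bidirected_cut_graph conn_cut_graph no_ucycle by (simp add: utree_def)

end

theorem proposition3p12:
  fixes G :: "'a pair_pre_digraph" and k :: nat
  assumes "pair_bidirected_digraph G"
    and "conn (with_proj G)"
    and "locally_finite (with_proj G)"
    and "accessible G"
    and "accessible_with G k"
  shows "utree (cut_graph G (cuts_opt G k)) (cut_graph_rev G (cuts_opt G k))"
proof -
  interpret pair_bidirected_digraph G by fact
  interpret accessible_pair_graph G k
    by unfold_locales (use assms in auto)
  interpret nested_cuts G "cuts_opt G k" k
    by unfold_locales (use cuts_opt_is_kcut cuts_opt_compl cuts_opt_nested in auto)
  show ?thesis by (rule utree_cut_graph)
qed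

end
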